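(* Let $(w,F)$ be one of the following two pairs: (Q) $w=(2,3,7,9)$ and $F=F_{Q_{16}}=X^4Z+Y^3+XZ^2+W^6Z+W^7Y$; (S) $w=(2,3,5,7)$ and $F=F_{S_{16}}=X^4Y+XZ^2+Y^2Z+W^5Z+W^6Y$. Let $\Delta\subset M_w\otimes_{\mathbb{Z}}\mathbb{R}$ be any reflexive polytope with $\Delta_F\subset\Delta\subset\Delta_w$. Then the polar dual polytope $\Delta':=\Delta^*\subset N_w\otimes_{\mathbb{Z}}\mathbb{R}$ is not a subpolytope of $\Delta_w$; that is, there is no isomorphism of lattices $\varphi:N_w\to M_w$ such that $\varphi_{\mathbb{R}}(\Delta^* )\subset\Delta_w$. In particular, the strange duality for the (self-dual) singularity $Q_{16}$ (in case (Q)), respectively $S_{16}$ (in case (S)), does not extend to polytope duality between subfamilies of $K3$ surfaces in $\mathbb{P}(w)$; that is, there are no reflexive polytopes $\Delta,\Delta'\subset M_w\otimes_{\mathbb{Z}}\mathbb{R}$ with $\Delta_F\subset\Delta\subset\Delta_w$, $\Delta_F\subset\Delta'\subset\Delta_w$ and $\Delta^*\simeq\Delta'$.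
   Context: For a quadruple of positive integers $w=(w_0,w_1,w_2,w_3)$ put $d:=w_0+w_1+w_2+w_3$, and let $\mathbb{P}(w)=\mathrm{Proj}\,\mathbb{C}[W,X,Y,Z]$ with $\deg W=w_0$, $\deg X=w_1$, $\deg Y=w_2$, $\deg Z=w_3$. (So $d=21$ for $w=(2,3,7,9)$ and $d=17$ for $w=(2,3,5,7)$.) Lattices: $M_w:=\{(i,j,k,l)\in\mathbb{Z}^4 \mid w_0i+w_1j+w_2k+w_3l=0\}$, a lattice of rank $3$, and $N_w:=\mathrm{Hom}_{\mathbb{Z}}(M_w,\mathbb{Z})$, with natural pairing $\langle\,,\,\rangle:N_w\times M_w\to\mathbb{Z}$ and its real extension $\langle\,,\,\rangle_{\mathbb{R}}$. A monomial $W^{i+1}X^{j+1}Y^{k+1}Z^{l+1}$ (all exponents $\ge 0$) of weighted degree $d$ corresponds to the point $(i,j,k,l)\in M_w$. Polytopes: a polytope is a $3$-dimensional convex hull of finitely many points. $\Delta_w\subset M_w\otimes_{\mathbb{Z}}\mathbb{R}$ is the convex hull of the points corresponding to all monomials of weighted degree $d$ in $W,X,Y,Z$. For a polynomial $F$ that is weighted homogeneous of degree $d$, its Newton polytope $\Delta_F\subset M_w\otimes_{\mathbb{Z}}\mathbb{R}$ is the convex hull of the points corresponding to the monomials appearing in $F$. Polar dual: for a polytope $\Delta\subset M_w\otimes\mathbb{R}$, $\Delta^*:=\{y\in N_w\otimes_{\mathbb{Z}}\mathbb{R} \mid \langle y,x\rangle_{\mathbb{R}}\ge -1 \text{ for all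 } x\in\Delta\}$. A polytope $\Delta$ with all vertices in the lattice is reflexive if the origin is the only lattice point in its interior and all vertices of $\Delta^*$ are lattice points. The notation $\Delta^*\simeq\Delta'$ means that some lattice isomorphism $N_w\to M_w$ maps $\Delta^*$ onto $\Delta'$. Singularities: $Q_{16}$ is defined by $x^4z+y^3+xz^2$ and $S_{16}$ by $x^4y+xz^2+y^2z$; each is strange dual to itself (the exponent matrices of these polynomials are symmetric). $F_{Q_{16}}$ and $F_{S_{16}}$ are their projectivisations, which are anticanonical sections of $\mathbb{P}(2,3,7,9)$ and $\mathbb{P}(2,3,5,7)$ respectively. Polytope duality: for strange dual singularities with projectivisations $F$ in $\mathbb{P}(w)$ and $F'$ in $\mathbb{P}(w')$ (anticanonical sections of Fano weighted projective spaces), the families of $K3$ surfaces $\mathcal{F}_\Delta$, $\mathcal{F}_{\Delta'}$ (general anticanonical sections of the toric Fano $3$-folds $\mathbb{P}_\Delta$, $\mathbb{P}_{\Delta'}$) associated to reflexive polytopes $\Delta,\Delta'$ are polytope dual if $\Delta_F\subset\Delta\subset\Delta_w$, $\Delta_{F'}\subset\Delta'\subset\Delta_{w'}$ and $\Delta^*\simeq\Delta'$. Here the singularities are self-dual, so $F'=F$ and $w'=w$. *)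

theory Defs
  imports "HOL-Analysis.Analysis" "HOL-Library.Poly_Mapping"
begin

text \<open>
  The coordinates \<open>1, 2, 3, 4\<close> of the index type \<^typ>\<open>4\<close> belong to
  the variables \<open>W, X, Y, Z\<close>, in this order.
\<close>

type_synonym monomial4 = "4 \<Rightarrow>\<^sub>0 nat"
type_synonym poly4 = "monomial4 \<Rightarrow>\<^sub>0 complex"

definition Var :: "4 \<Rightarrow> poly4" where
  "Var i = Poly_Mapping.single (Poly_Mapping.single i 1) 1"

definition total_weight :: "nat^4 \<Rightarrow> nat" where
  "total_weight w = (\<Sum>i\<in>UNIV. w $ i)"

definition weighted_degree :: "nat^4 \<Rightarrow> monomial4 \<Rightarrow> nat" where
  "weighted_degree w m = (\<Sum>i\<in>UNIV. w $ i * Poly_Mapping.lookup m i)"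


text \<open>
  \<open>M_real w\<close> is \<open>M\<^sub>w \<otimes> \<real>\<close>, and the lattice \<open>M\<^sub>w\<close> is regarded as a subset of it.
\<close>

definition M_real :: "nat^4 \<Rightarrow> (real^4) set" where
  "M_real w = {x. (\<Sum>i\<in>UNIV. real (w $ i) * x $ i) = 0}"

definition M_lattice :: "nat^4 \<Rightarrow> (real^4) set" where
  "M_lattice w = {x \<in> M_real w. \<forall>i. x $ i \<in> \<int>}"

text \<open>
  \<open>N\<^sub>w \<otimes> \<real>\<close> is the space of linear functionals on \<open>M\<^sub>w \<otimes> \<real>\<close>. Such a functional is represented
  by its unique linear extension to \<open>\<real>\<^sup>4\<close> that vanishes on the vector \<open>w\<close>, which spans the
  orthogonal complement of \<open>M\<^sub>w \<otimes> \<real>\<close>. The pairing \<open>\<langle>y, x\<rangle>\<close> is the application of \<open>y\<close> to \<open>x\<close>.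
  As \<open>M\<^sub>w\<close> spans \<open>M\<^sub>w \<otimes> \<real>\<close>, the group \<open>N\<^sub>w = Hom(M\<^sub>w, \<int>)\<close> consists of the functionals that are
  integral on \<open>M\<^sub>w\<close>.
\<close>

definition N_real :: "nat^4 \<Rightarrow> ((real^4) \<Rightarrow>\<^sub>L real) set" where
  "N_real w = {y. blinfun_apply y (\<chi> i. real (w $ i)) = 0}"

definition N_lattice :: "nat^4 \<Rightarrow> ((real^4) \<Rightarrow>\<^sub>L real) set" where
  "N_lattice w = {y \<in> N_real w. \<forall>x \<in> M_lattice w. blinfun_apply y x \<in> \<int>}"

text \<open>
  A lattice isomorphism \<open>N\<^sub>w \<rightarrow> M\<^sub>w\<close> is given together with its real extension: \<open>\<phi>\<close> is linear
  and restricts to a bijection of the lattices. Only the values of \<open>\<phi>\<close> on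
  \<^term>\<open>N_real w\<close> matter, and these are determined by the values on \<^term>\<open>N_lattice w\<close>.
\<close>

definition lattice_iso :: "nat^4 \<Rightarrow> (((real^4) \<Rightarrow>\<^sub>L real) \<Rightarrow> real^4) \<Rightarrow> bool" where
  "lattice_iso w \<phi> \<longleftrightarrow> linear \<phi> \<and> bij_betw \<phi> (N_lattice w) (M_lattice w)"

text \<open>The monomial \<open>WXYZ\<close> corresponds to the origin.\<close>

definition monomial_point :: "monomial4 \<Rightarrow> real^4" where
  "monomial_point m = (\<chi> i. real (Poly_Mapping.lookup m i) - 1)"

definition Delta_weight :: "nat^4 \<Rightarrow> (real^4) set" where
  "Delta_weight w = convex hull (monomial_point ` {m. weighted_degree w m = total_weight w})"

definition Newton_polytope :: "poly4 \<Rightarrow> (real^4) set" where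
  "Newton_polytope F = convex hull (monomial_point ` Poly_Mapping.keys F)"

definition polytope_in :: "nat^4 \<Rightarrow> (real^4) set \<Rightarrow> bool" where
  "polytope_in w \<Delta> \<longleftrightarrow> \<Delta> \<subseteq> M_real w \<and> polytope \<Delta> \<and> aff_dim \<Delta> = 3"

definition polar_dual :: "nat^4 \<Rightarrow> (real^4) set \<Rightarrow> ((real^4) \<Rightarrow>\<^sub>L real) set" where
  "polar_dual w \<Delta> = {y \<in> N_real w. \<forall>x \<in> \<Delta>. blinfun_apply y x \<ge> -1}"

text \<open>
  For a 3-dimensional subset of the 3-dimensional space \<^term>\<open>M_real w\<close>, the interior in this
  space is the relative interior; vertices are extreme points.
\<close>

definition reflexive :: "nat^4 \<Rightarrow> (real^4) set \<Rightarrow> bool" where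
  "reflexive w \<Delta> \<longleftrightarrow>
     polytope_in w \<Delta> \<and>
     (\<forall>v. v extreme_point_of \<Delta> \<longrightarrow> v \<in> M_lattice w) \<and>
     rel_interior \<Delta> \<inter> M_lattice w = {0} \<and>
     (\<forall>y. y extreme_point_of polar_dual w \<Delta> \<longrightarrow> y \<in> N_lattice w)"

definition w_Q16 :: "nat^4" where
  "w_Q16 = vector [2, 3, 7, 9]"

definition F_Q16 :: poly4 where
  "F_Q16 = (let W = Var 1; X = Var 2; Y = Var 3; Z = Var 4 in
     X^4 * Z + Y^3 + X * Z^2 + W^6 * Z + W^7 * Y)"

definition w_S16 :: "nat^4" where
  "w_S16 = vector [2, 3, 5, 7]"

definition F_S16 :: poly4 where
  "F_S16 = (let W = Var 1; X = Var 2; Y = Var 3; Z = Var 4 in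
     X^4 * Y + X * Z^2 + Y^2 * Z + W^5 * Z + W^6 * Y)"

end

theory Submission imports Defs
begin

text \<open>
  Since \<open>\<Delta> \<subseteq> \<Delta>\<^sub>w\<close> and all coordinates are at least \<open>-1\<close> on \<open>\<Delta>\<^sub>w\<close>, the four coordinate functionals
  \<open>e\<^sub>j\<close> lie in \<open>\<Delta>\<^sup>*\<close>. If \<open>\<phi>\<close> maps \<open>\<Delta>\<^sup>*\<close> into \<open>\<Delta>\<^sub>w\<close>, then the lattice points \<open>\<phi>(e\<^sub>j)\<close> are the columns of an
  integer matrix with entries at least \<open>-1\<close> whose rows and columns are all orthogonal to \<open>w\<close>, that is,
  correspond to monomials of degree \<open>d\<close>. There are few such matrices (4 in case (Q), 12 in case (S)),
  and each has rank at most 2, whereas \<open>\<phi>\<close> is injective and the \<open>e\<^sub>j\<close> span a space of dimension 3.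
\<close>

section \<open>Coordinate functionals as points of the polar dual\<close>

definition weight_vec :: "nat^4 \<Rightarrow> real^4" where
  "weight_vec w = (\<chi> i. real (w $ i))"

text \<open>
  The functional \<open>x \<mapsto> c \<bullet> x\<close> on \<^term>\<open>M_real w\<close>; projecting \<open>c\<close> away from the weights yields its
  representative in \<^term>\<open>N_real w\<close>.
\<close>

definition dual_vec :: "nat^4 \<Rightarrow> real^4 \<Rightarrow> (real^4) \<Rightarrow>\<^sub>L real" where
  "dual_vec w c =
     blinfun_inner_right (c - ((c \<bullet> weight_vec w) / (weight_vec w \<bullet> weight_vec w)) *\<^sub>R weight_vec w)"

lemma M_real_iff_inner: "x \<in> M_real w \<longleftrightarrow> weight_vec w \<bullet> x = 0"
  by (simp add: M_real_def weight_vec_def inner_vec_def)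

lemma weight_vec_eq_0_iff [simp]: "weight_vec w = 0 \<longleftrightarrow> w = 0"
  by (simp add: weight_vec_def vec_eq_iff)

lemma linear_dual_vec: "linear (dual_vec w)"
  by (rule linearI)
    (auto intro!: blinfun_eqI simp: dual_vec_def blinfun.bilinear_simps algebra_simps inner_simps
      add_divide_distrib)

lemma dual_vec_apply: "x \<in> M_real w \<Longrightarrow> blinfun_apply (dual_vec w c) x = c \<bullet> x"
  by (simp add: dual_vec_def M_real_iff_inner inner_simps)

lemma dual_vec_in_N_real: "w \<noteq> 0 \<Longrightarrow> dual_vec w c \<in> N_real w"
  by (simp add: N_real_def dual_vec_def inner_simps flip: weight_vec_def)

lemma dual_vec_weight_vec: "w \<noteq> 0 \<Longrightarrow> dual_vec w (weight_vec w) = 0"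
  by (auto intro!: blinfun_eqI simp: dual_vec_def)

text \<open>The projected coefficient vector need not be integral, but integrality is tested on
  \<open>M_lattice w\<close> only, where the functional is still
  \<open>c \<bullet> x\<close>.\<close>

lemma dual_vec_in_N_lattice:
  assumes "w \<noteq> 0" and "\<And>i. c $ i \<in> \<int>"
  shows "dual_vec w c \<in> N_lattice w"
  using assms
  by (auto simp: N_lattice_def M_lattice_def dual_vec_in_N_real dual_vec_apply inner_vec_def
      intro!: Ints_sum Ints_mult)

lemma Delta_weight_ge: "x \<in> Delta_weight w \<Longrightarrow> -1 \<le> x $ i"
proof -
  have "convex {x :: real^4. axis i 1 \<bullet> x \<ge> -1}"
    by (rule convex_halfspace_ge)
  then have "Delta_weight w \<subseteq> {x. axis i 1 \<bullet> x \<ge> -1}"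
    unfolding Delta_weight_def
    by (intro hull_minimal) (auto simp: monomial_point_def inner_axis')
  then show "x \<in> Delta_weight w \<Longrightarrow> -1 \<le> x $ i"
    by (auto simp: inner_axis')
qed

lemma dual_vec_axis_in_polar_dual:
  assumes "w \<noteq> 0" "\<Delta> \<subseteq> M_real w" "\<Delta> \<subseteq> Delta_weight w"
  shows "dual_vec w (axis j 1) \<in> polar_dual w \<Delta>"
  using assms Delta_weight_ge[of _ w j]
  by (auto simp: polar_dual_def dual_vec_in_N_real dual_vec_apply inner_axis' subset_iff)

text \<open>
  Column \<open>j\<close> of the matrix \<open>A\<close> is the image under \<open>\<phi>\<close> of the \<open>j\<close>-th coordinate functional. The
  coordinate functionals satisfy no linear relation but the one given by the weights, so neither
  do the columns.
\<close>

lemma lattice_iso_matrix: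
  assumes w: "w \<noteq> 0" and \<phi>: "lattice_iso w \<phi>" "\<phi> ` polar_dual w \<Delta> \<subseteq> Delta_weight w"
    and \<Delta>: "\<Delta> \<subseteq> M_real w" "\<Delta> \<subseteq> Delta_weight w"
  obtains A :: "4 \<Rightarrow> 4 \<Rightarrow> int" where
    "\<And>i j. -1 \<le> A i j"
    "\<And>i. (\<Sum>j\<in>UNIV. int (w $ j) * A i j) = 0"
    "\<And>j. (\<Sum>i\<in>UNIV. int (w $ i) * A i j) = 0"
    "\<And>c x. (\<And>i. (\<Sum>j\<in>UNIV. c $ j * A i j) = 0) \<Longrightarrow> x \<in> M_real w \<Longrightarrow>
       (\<Sum>j\<in>UNIV. of_int (c $ j) * x $ j) = 0"
proof -
  have lin: "linear \<phi>" and bij: "bij_betw \<phi> (N_lattice w) (M_lattice w)"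
    using \<phi>(1) by (auto simp: lattice_iso_def)
  define v where "v j = \<phi> (dual_vec w (axis j 1))" for j
  have expand: "\<phi> (dual_vec w c) = (\<Sum>j\<in>UNIV. c $ j *\<^sub>R v j)" for c
  proof -
    have lin': "linear (\<lambda>c. \<phi> (dual_vec w c))"
      using linear_compose[OF linear_dual_vec lin] by (simp add: o_def)
    have "\<phi> (dual_vec w c) = \<phi> (dual_vec w (\<Sum>j\<in>UNIV. c $ j *\<^sub>R axis j 1))"
      using basis_expansion[of c] by (simp add: scalar_mult_eq_scaleR)
    also have "\<dots> = (\<Sum>j\<in>UNIV. c $ j *\<^sub>R v j)"
      by (simp add: linear_sum[OF lin'] linear_scale[OF lin'] v_def)
    finally show ?thesis .
  qed
  have v_lattice: "v j \<in> M_lattice w" for j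
    using bij_betwE[OF bij] dual_vec_in_N_lattice[OF w, of "axis j 1"]
    by (auto simp: v_def axis_def)
  define A where "A i j = \<lfloor>v j $ i\<rfloor>" for i j
  have A: "v j $ i = of_int (A i j)" for i j
    using v_lattice[of j] by (simp add: A_def M_lattice_def)
  have "-1 \<le> A i j" for i j
  proof -
    have "v j \<in> Delta_weight w"
      using \<phi>(2) dual_vec_axis_in_polar_dual[OF w \<Delta>] by (auto simp: v_def)
    from Delta_weight_ge[OF this, of i] show ?thesis
      by (simp add: A)
  qed
  moreover have "(\<Sum>j\<in>UNIV. int (w $ j) * A i j) = 0" for i
  proof -
    \<comment> \<open>The weights, read as coefficients, give the zero functional.\<close>
    have "(\<Sum>j\<in>UNIV. weight_vec w $ j *\<^sub>R v j) = 0"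
      unfolding expand[symmetric] by (simp add: dual_vec_weight_vec w linear_0[OF lin])
    then have "real_of_int (\<Sum>j\<in>UNIV. int (w $ j) * A i j) = 0"
      by (simp add: vec_eq_iff A weight_vec_def)
    then show ?thesis
      by (simp only: of_int_eq_0_iff)
  qed
  moreover have "(\<Sum>i\<in>UNIV. int (w $ i) * A i j) = 0" for j
  proof -
    have "real_of_int (\<Sum>i\<in>UNIV. int (w $ i) * A i j) = 0"
      using v_lattice[of j] by (simp add: M_lattice_def M_real_def A)
    then show ?thesis
      by (simp only: of_int_eq_0_iff)
  qed
  moreover have "(\<Sum>j\<in>UNIV. of_int (c $ j) * x $ j) = 0"
    if c: "\<And>i. (\<Sum>j\<in>UNIV. c $ j * A i j) = 0" and x: "x \<in> M_real w"
    for c :: "int^4" and x :: "real^4"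
  proof -
    define c' :: "real^4" where "c' = (\<chi> j. of_int (c $ j))"
    have "\<phi> (dual_vec w c') $ i = of_int (\<Sum>j\<in>UNIV. c $ j * A i j)" for i
      by (simp add: expand A c'_def)
    then have "\<phi> (dual_vec w c') = \<phi> 0"
      by (simp only: c vec_eq_iff linear_0[OF lin] of_int_0 zero_index simp_thms)
    \<comment> \<open>Injectivity of \<open>\<phi>\<close> is known on \<open>N_lattice w\<close>
      only; this is why \<open>c\<close> is taken integral.\<close>
    moreover have "dual_vec w c' \<in> N_lattice w" "dual_vec w 0 \<in> N_lattice w"
      by (auto intro!: dual_vec_in_N_lattice[OF w] simp: c'_def)
    ultimately have "dual_vec w c' = 0"
      using inj_onD[OF bij_betw_imp_inj_on[OF bij], of "dual_vec w c'" 0]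
      by (simp add: linear_0[OF linear_dual_vec])
    with dual_vec_apply[OF x, of c'] show ?thesis
      by (simp add: inner_vec_def c'_def)
  qed
  ultimately show ?thesis
    by (rule that)
qed

section \<open>Enumeration of the monomials of degree d and of the matrices built from them\<close>

lemma monomials_Q16:
  fixes a b c d :: int
  assumes "-1 \<le> a" "-1 \<le> b" "-1 \<le> c" "-1 \<le> d" "2 * a + 3 * b + 7 * c + 9 * d = 0"
  shows "(a, b, c, d) \<in>
    {(8, 0, -1, -1), (5, 2, -1, -1), (2, 4, -1, -1), (-1, 6, -1, -1),
     (6, -1, 0, -1), (3, 1, 0, -1), (0, 3, 0, -1), (1, 0, 1, -1),
     (-1, -1, 2, -1), (5, -1, -1, 0), (2, 1, -1, 0), (-1, 3, -1, 0),
     (0, 0, 0, 0), (-1, 0, -1, 1)}"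
proof -
  \<comment> \<open>Since 2 and 3 are coprime, \<open>t\<close> parametrizes the integer solutions
    of 2a + 3b = n for fixed n = -7c - 9d; this leaves a search over a finite box.\<close>
  define t where "t = a + b"
  have a: "a = 3 * t + 7 * c + 9 * d" and b: "b = - 2 * t - 7 * c - 9 * d"
    using assms(5) by (simp_all add: t_def)
  have ge: "-1 \<le> 3 * t + 7 * c + 9 * d" "-1 \<le> - 2 * t - 7 * c - 9 * d"
    using assms(1,2) by (simp_all only: a b)
  have "d \<in> set [-1..1]" "c \<in> set [-1..2]" "t \<in> set [-2..8]"
    unfolding set_upto atLeastAtMost_iff using assms(3,4) ge by (intro conjI; linarith)+
  then show ?thesis
    using ge unfolding a b by (simp add: upto.simps) (elim disjE; simp)
qed

lemma monomials_S16:
  fixes a b c d :: int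
  assumes "-1 \<le> a" "-1 \<le> b" "-1 \<le> c" "-1 \<le> d" "2 * a + 3 * b + 5 * c + 7 * d = 0"
  shows "(a, b, c, d) \<in>
    {(6, 0, -1, -1), (3, 2, -1, -1), (0, 4, -1, -1), (5, -1, 0, -1),
     (2, 1, 0, -1), (-1, 3, 0, -1), (1, 0, 1, -1), (0, -1, 2, -1),
     (4, -1, -1, 0), (1, 1, -1, 0), (0, 0, 0, 0), (-1, -1, 1, 0),
     (-1, 0, -1, 1)}"
proof -
  define t where "t = a + b"
  have a: "a = 3 * t + 5 * c + 7 * d" and b: "b = - 2 * t - 5 * c - 7 * d"
    using assms(5) by (simp_all add: t_def)
  have ge: "-1 \<le> 3 * t + 5 * c + 7 * d" "-1 \<le> - 2 * t - 5 * c - 7 * d"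
    using assms(1,2) by (simp_all only: a b)
  have "d \<in> set [-1..1]" "c \<in> set [-1..2]" "t \<in> set [-2..6]"
    unfolding set_upto atLeastAtMost_iff using assms(3,4) ge by (intro conjI; linarith)+
  then show ?thesis
    using ge unfolding a b by (simp add: upto.simps) (elim disjE; simp)
qed

text \<open>Each alternative is a linear relation between the columns that is not a multiple of the
  weight relation, so the rank is at most 2.\<close>

lemma matrix_relation_Q16:
  fixes A :: "4 \<Rightarrow> 4 \<Rightarrow> int"
  assumes ge: "\<And>i j. -1 \<le> A i j"
    and rows: "\<And>i. 2 * A i 1 + 3 * A i 2 + 7 * A i 3 + 9 * A i 4 = 0"
    and cols: "\<And>j. 2 * A 1 j + 3 * A 2 j + 7 * A 3 j + 9 * A 4 j = 0"
  shows "(\<forall>i. A i 2 = 0) \<or>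
         (\<forall>i. A i 1 - 2 * A i 2 + A i 4 = 0)"
proof -
  note col = monomials_Q16[OF ge ge ge ge cols]
  note row = monomials_Q16[OF ge ge ge ge rows]
  have "A 4 j \<le> 1" "A 3 j \<le> 2" for j
    using col[of j] by auto
  then have le: "\<forall>j. A 4 j \<le> 1" "\<forall>j. A 3 j \<le> 2"
    by blast+
  \<comment> \<open>The columns being monomials too, heavy weights bound the entries of the last two
    rows, which leaves 3 * 5 choices for these rows.\<close>
  have "(A 4 1, A 4 2, A 4 3, A 4 4) \<in>
      {(1, 0, 1, -1), (0, 0, 0, 0), (-1, 0, -1, 1)}"
    using row[of 4] le(1) by (auto simp: forall_4)
  moreover have "(A 3 1, A 3 2, A 3 3, A 3 4) \<in>
      {(1, 0, 1, -1), (-1, -1, 2, -1), (2, 1, -1, 0), (0, 0, 0, 0), (-1, 0, -1, 1)}"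
    using row[of 3] le(2) by (auto simp: forall_4)
  ultimately show ?thesis
    unfolding forall_4
    \<comment> \<open>Once rows 3 and 4 are fixed, the last two entries of each column are known and
      few columns remain; the equations of rows 1 and 2 select the compatible ones.\<close>
    by (elim insertE emptyE; insert col[of 1] col[of 2] col[of 3] col[of 4] rows[of 1] rows[of 2];
        simp; elim disjE conjE; simp)
qed

lemma matrix_relation_S16:
  fixes A :: "4 \<Rightarrow> 4 \<Rightarrow> int"
  assumes ge: "\<And>i j. -1 \<le> A i j"
    and rows: "\<And>i. 2 * A i 1 + 3 * A i 2 + 5 * A i 3 + 7 * A i 4 = 0"
    and cols: "\<And>j. 2 * A 1 j + 3 * A 2 j + 5 * A 3 j + 7 * A 4 j = 0"
  shows "(\<forall>i. A i 2 = 0) \<or>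
         (\<forall>i. A i 4 = 0) \<or>
         (\<forall>i. A i 1 + A i 3 + 2 * A i 4 = 0) \<or>
         (\<forall>i. A i 2 + A i 3 + A i 4 = 0)"
proof -
  note col = monomials_S16[OF ge ge ge ge cols]
  note row = monomials_S16[OF ge ge ge ge rows]
  have "A 4 j \<le> 1" "A 3 j \<le> 2" for j
    using col[of j] by auto
  then have le: "\<forall>j. A 4 j \<le> 1" "\<forall>j. A 3 j \<le> 2"
    by blast+
  \<comment> \<open>The same bounds leave 5 * 7 choices here.\<close>
  have "(A 4 1, A 4 2, A 4 3, A 4 4) \<in>
      {(1, 0, 1, -1), (1, 1, -1, 0), (0, 0, 0, 0), (-1, -1, 1, 0), (-1, 0, -1, 1)}"
    using row[of 4] le(1) by (auto simp: forall_4)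
  moreover have "(A 3 1, A 3 2, A 3 3, A 3 4) \<in>
      {(2, 1, 0, -1), (1, 0, 1, -1), (0, -1, 2, -1), (1, 1, -1, 0), (0, 0, 0, 0),
       (-1, -1, 1, 0), (-1, 0, -1, 1)}"
    using row[of 3] le(2) by (auto simp: forall_4)
  ultimately show ?thesis
    unfolding forall_4
    by (elim insertE emptyE; insert col[of 1] col[of 2] col[of 3] col[of 4] rows[of 1] rows[of 2];
        simp; elim disjE conjE; simp)
qed

section \<open>Contradiction with the independence of the columns\<close>

lemma polar_dual_not_subset_Q16:
  assumes \<phi>: "lattice_iso w_Q16 \<phi>" and \<Delta>: "\<Delta> \<subseteq> M_real w_Q16" "\<Delta> \<subseteq> Delta_weight w_Q16"
  shows "\<not> \<phi> ` polar_dual w_Q16 \<Delta> \<subseteq> Delta_weight w_Q16"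
proof
  assume sub: "\<phi> ` polar_dual w_Q16 \<Delta> \<subseteq> Delta_weight w_Q16"
  have w: "w_Q16 $ 1 = 2" "w_Q16 $ 2 = 3" "w_Q16 $ 3 = 7" "w_Q16 $ 4 = 9"
    by (simp_all add: w_Q16_def vector_def)
  then have "w_Q16 \<noteq> 0"
    by auto
  then obtain A :: "4 \<Rightarrow> 4 \<Rightarrow> int" where A: "\<And>i j. -1 \<le> A i j"
    "\<And>i. (\<Sum>j\<in>UNIV. int (w_Q16 $ j) * A i j) = 0"
    "\<And>j. (\<Sum>i\<in>UNIV. int (w_Q16 $ i) * A i j) = 0"
    and indep: "\<And>c x. (\<And>i. (\<Sum>j\<in>UNIV. c $ j * A i j) = 0) \<Longrightarrow> x \<in> M_real w_Q16 \<Longrightarrow>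
       (\<Sum>j\<in>UNIV. of_int (c $ j) * x $ j) = 0"
    using lattice_iso_matrix[OF _ \<phi> sub \<Delta>] by blast
  \<comment> \<open>A test point at which both relations are nonzero, with values 2 and -7.\<close>
  have "(vector [-3, 2, 0, 0] :: real^4) \<in> M_real w_Q16"
    by (simp add: M_real_def sum_4 w vector_def)
  note indep = indep[OF _ this]
  from A(2,3) have "\<And>i. 2 * A i 1 + 3 * A i 2 + 7 * A i 3 + 9 * A i 4 = 0"
    and "\<And>j. 2 * A 1 j + 3 * A 2 j + 7 * A 3 j + 9 * A 4 j = 0"
    by (simp_all add: sum_4 w)
  from matrix_relation_Q16[OF A(1) this] show False
    using indep[of "vector [0, 1, 0, 0]"] indep[of "vector [1, -2, 0, 1]"]
    by (auto simp: sum_4 vector_def)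
qed

lemma polar_dual_not_subset_S16:
  assumes \<phi>: "lattice_iso w_S16 \<phi>" and \<Delta>: "\<Delta> \<subseteq> M_real w_S16" "\<Delta> \<subseteq> Delta_weight w_S16"
  shows "\<not> \<phi> ` polar_dual w_S16 \<Delta> \<subseteq> Delta_weight w_S16"
proof
  assume sub: "\<phi> ` polar_dual w_S16 \<Delta> \<subseteq> Delta_weight w_S16"
  have w: "w_S16 $ 1 = 2" "w_S16 $ 2 = 3" "w_S16 $ 3 = 5" "w_S16 $ 4 = 7"
    by (simp_all add: w_S16_def vector_def)
  then have "w_S16 \<noteq> 0"
    by auto
  then obtain A :: "4 \<Rightarrow> 4 \<Rightarrow> int" where A: "\<And>i j. -1 \<le> A i j"
    "\<And>i. (\<Sum>j\<in>UNIV. int (w_S16 $ j) * A i j) = 0"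
    "\<And>j. (\<Sum>i\<in>UNIV. int (w_S16 $ i) * A i j) = 0"
    and indep: "\<And>c x. (\<And>i. (\<Sum>j\<in>UNIV. c $ j * A i j) = 0) \<Longrightarrow> x \<in> M_real w_S16 \<Longrightarrow>
       (\<Sum>j\<in>UNIV. of_int (c $ j) * x $ j) = 0"
    using lattice_iso_matrix[OF _ \<phi> sub \<Delta>] by blast
  \<comment> \<open>One point refutes all four relations: their values are 2, -5, -6 and 4.\<close>
  have "(vector [-3, 2, 7, -5] :: real^4) \<in> M_real w_S16"
    by (simp add: M_real_def sum_4 w vector_def)
  note indep = indep[OF _ this]
  from A(2,3) have "\<And>i. 2 * A i 1 + 3 * A i 2 + 5 * A i 3 + 7 * A i 4 = 0"
    and "\<And>j. 2 * A 1 j + 3 * A 2 j + 5 * A 3 j + 7 * A 4 j = 0"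
    by (simp_all add: sum_4 w)
  from matrix_relation_S16[OF A(1) this] show False
    using indep[of "vector [0, 1, 0, 0]"] indep[of "vector [0, 0, 0, 1]"]
      indep[of "vector [1, 0, 1, 2]"] indep[of "vector [0, 1, 1, 1]"]
    by (auto simp: sum_4 vector_def)
qed

theorem theorem3p1:
  fixes w :: "nat^4" and F :: poly4
  assumes "(w = w_Q16 \<and> F = F_Q16) \<or> (w = w_S16 \<and> F = F_S16)"
  shows "(\<forall>\<Delta>. reflexive w \<Delta> \<and> Newton_polytope F \<subseteq> \<Delta> \<and> \<Delta> \<subseteq> Delta_weight w \<longrightarrow>
            \<not> (\<exists>\<phi>. lattice_iso w \<phi> \<and> \<phi> ` polar_dual w \<Delta> \<subseteq> Delta_weight w)) \<and>
         \<not> (\<exists>\<Delta> \<Delta>'. reflexive w \<Delta> \<and> reflexive w \<Delta>' \<and>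
              Newton_polytope F \<subseteq> \<Delta> \<and> \<Delta> \<subseteq> Delta_weight w \<and>
              Newton_polytope F \<subseteq> \<Delta>' \<and> \<Delta>' \<subseteq> Delta_weight w \<and>
              (\<exists>\<phi>. lattice_iso w \<phi> \<and> \<phi> ` polar_dual w \<Delta> = \<Delta>'))"
proof -
  have "\<not> \<phi> ` polar_dual w \<Delta> \<subseteq> Delta_weight w"
    if "lattice_iso w \<phi>" "reflexive w \<Delta>" "\<Delta> \<subseteq> Delta_weight w" for \<phi> \<Delta>
    using that assms polar_dual_not_subset_Q16 polar_dual_not_subset_S16
    by (auto simp: reflexive_def polytope_in_def)
  then show ?thesis
    by blast
qed

end
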